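(* There exist absolute constants $\varepsilon_0>0$ and $c>0$ such that the following holds. Let $N,M,T$ be positive integers and $\varepsilon\in(0,\varepsilon_0)$ with $N\ge MT/\varepsilon^2$. Let $\mathcal{H}$ be any family of hash functions $[N]\to[M]$ and $H$ a uniformly random member of $\mathcal{H}$. Then there exist an integer $K\ge c\,MT/\varepsilon^2$ and a block $K$-source $\mathbf{X}=(X_1,\dots,X_T)$ over $[N]^T$ (independent of $H$) such that $(H,\mathbf{Y})=(H,H(X_1),\dots,H(X_T))$ is $\varepsilon$-far in statistical distance from $(H,U_{[M]^T})$.
   Context: $[n]=\{1,\dots,n\}$. A hash family is a multiset of functions $[N]\to[M]$. $\mathrm{cp}(X)=\sum_x\Pr[X=x]^2$. A sequence $(X_1,\dots,X_T)$ over $[N]^T$ is a block $K$-source if for every $i$ and every $x_{<i}$ in the support of $(X_1,\dots,X_{i-1})$, $\mathrm{cp}(X_i\mid X_{<i}=x_{<i})\le 1/K$. $U_{[M]^T}$ is uniform over $[M]^T$ and independent of $H$. Statistical distance: $\Delta(X,Y)=\max_S|\Pr[X\in S]-\Pr[Y\in S]|$; $X$ is $\varepsilon$-far from $Y$ if $\Delta(X,Y)\ge\varepsilon$.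
   Formalization: The formal theorem requires M > 1 instead of M positive: for M = 1 every hash function is constant, so (H,Y) and (H,U) have the same distribution and distance 0 < ε, and the claim fails. *)

theory Defs
  imports "HOL-Probability.Probability"
begin

definition collision_prob :: "'a pmf \<Rightarrow> real" where
  "collision_prob p = (\<Sum>\<^sub>\<infinity>x. (pmf p x)\<^sup>2)"

text \<open>
  The maximum over all events \<open>S\<close> is taken as a supremum; the absolute differences are bounded
  by 1, and for distributions of finite support the supremum is attained.
\<close>
definition stat_dist :: "'a pmf \<Rightarrow> 'a pmf \<Rightarrow> real" where
  "stat_dist p q = (SUP S. \<bar>measure_pmf.prob p S - measure_pmf.prob q S\<bar>)"

definition eps_far :: "real \<Rightarrow> 'a pmf \<Rightarrow> 'a pmf \<Rightarrow> bool" where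
  "eps_far \<epsilon> p q \<longleftrightarrow> stat_dist p q \<ge> \<epsilon>"

definition tuples :: "nat \<Rightarrow> 'a set \<Rightarrow> 'a list set" where
  "tuples T A = {xs. set xs \<subseteq> A \<and> length xs = T}"

text \<open>
  A sequence of jointly distributed variables \<open>X\<^sub>1, \<dots>, X\<^sub>T\<close> is the joint distribution \<open>X\<close> of the
  list of their values. List positions start at 0, so \<open>xs ! i\<close> is the value of the variable
  with subscript \<open>i + 1\<close> and \<open>take i xs\<close> lists the values strictly before it (for \<open>i = 0\<close> it is
  empty, so there is no conditioning).
\<close>
definition block_source :: "nat \<Rightarrow> nat \<Rightarrow> 'a set \<Rightarrow> 'a list pmf \<Rightarrow> bool" where
  "block_source K T A X \<longleftrightarrow>
     set_pmf X \<subseteq> tuples T A \<and>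
     (\<forall>i<T. \<forall>ys\<in>set_pmf (map_pmf (take i) X).
        collision_prob (map_pmf (\<lambda>xs. xs ! i) (cond_pmf X {xs. take i xs = ys})) \<le> 1 / real K)"

text \<open>
  A hash family is finite and nonempty, so that a uniformly random member exists; repeated
  functions count with their multiplicity. Functions \<open>[N] \<rightarrow> [M]\<close> are extensional, so that
  distinct members differ on \<open>[N]\<close>.
\<close>
definition hash_family :: "nat \<Rightarrow> nat \<Rightarrow> (nat \<Rightarrow> nat) multiset \<Rightarrow> bool" where
  "hash_family N M \<H> \<longleftrightarrow> \<H> \<noteq> {#} \<and> set_mset \<H> \<subseteq> {1..N} \<rightarrow>\<^sub>E {1..M}"

text \<open>
  The joint distribution of \<open>(H, H(X\<^sub>1), \<dots>, H(X\<^sub>T))\<close> for \<open>H\<close> uniform in \<open>\<H>\<close> and independent of \<open>X\<close>.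
\<close>
definition hashed_source ::
    "(nat \<Rightarrow> nat) multiset \<Rightarrow> nat list pmf \<Rightarrow> ((nat \<Rightarrow> nat) \<times> nat list) pmf" where
  "hashed_source \<H> X = map_pmf (\<lambda>(h, xs). (h, map h xs)) (pair_pmf (pmf_of_multiset \<H>) X)"

definition ideal_source ::
    "(nat \<Rightarrow> nat) multiset \<Rightarrow> nat \<Rightarrow> nat \<Rightarrow> ((nat \<Rightarrow> nat) \<times> nat list) pmf" where
  "ideal_source \<H> T M = pair_pmf (pmf_of_multiset \<H>) (pmf_of_set (tuples T {1..M}))"

end

theory Submission
  imports Defs
begin

text \<open>
  Let \<open>n\<close> be a small constant times \<open>MT/\<epsilon>\<^sup>2\<close>, and let \<open>X\<^sub>1, \<dots>, X\<^sub>T\<close> be independent copies of a random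
  perturbation by signs \<open>\<sigma>\<^sub>x\<close> of the uniform distribution on \<open>[n]\<close>, with weights proportional to
  \<open>2 + \<sigma>\<^sub>x\<close>. For every hash function \<open>h\<close> and bin \<open>y\<close> the deviation of \<open>Pr[h(X\<^sub>1) = y]\<close> from \<open>1/M\<close> is
  essentially an affine function of the signs, so a Khintchine inequality shows that it is typically
  of relative order \<open>(M/n)\<^sup>1\<^sup>/\<^sup>2\<close>, that is \<open>\<epsilon>/T\<^sup>1\<^sup>/\<^sup>2\<close>. Averaging over \<open>\<H>\<close>, over the bins and over the
  signs yields one choice of signs that is good on average over \<open>h\<close>. Passing to \<open>T\<close> independent copies
  multiplies a distance \<open>\<delta> \<le> T\<^sup>-\<^sup>1\<^sup>/\<^sup>2\<close> from uniform by order \<open>T\<^sup>1\<^sup>/\<^sup>2\<close>: this is detected by a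
  complex-valued test function of product form, whose expectation under a product measure is a
  \<open>T\<close>-th power.
\<close>

section \<open>Moments of random signed sums\<close>

text \<open>A subset \<open>S\<close> of \<open>I\<close> encodes the sign vector that is 1 on
  \<open>S\<close> and -1 elsewhere. Averaging over independent uniform signs is then summing over
  \<open>Pow I\<close> and dividing by \<open>2 ^ card I\<close>.\<close>

definition signed_sum :: "'a set \<Rightarrow> ('a \<Rightarrow> real) \<Rightarrow> 'a set \<Rightarrow> real" where
  "signed_sum I a S = (\<Sum>x\<in>I. if x \<in> S then a x else - a x)"

lemma sum_Pow_insert:
  assumes "finite I" "x \<notin> I"
  shows "sum f (Pow (insert x I)) = (\<Sum>S\<in>Pow I. f S + f (insert x S))"
proof -
  have inj: "inj_on (insert x) (Pow I)"
    using assms(2) by (auto simp: inj_on_def)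
  have "sum f (Pow (insert x I)) = sum f (Pow I) + sum f (insert x ` Pow I)"
    unfolding Pow_insert using assms by (intro sum.union_disjoint) auto
  also have "sum f (insert x ` Pow I) = (\<Sum>S\<in>Pow I. f (insert x S))"
    using inj by (simp add: sum.reindex)
  finally show ?thesis by (simp add: sum.distrib)
qed

lemma signed_sum_insert:
  assumes "finite I" "x \<notin> I" "S \<subseteq> I"
  shows "signed_sum (insert x I) a S = signed_sum I a S - a x"
    and "signed_sum (insert x I) a (insert x S) = signed_sum I a S + a x"
proof -
  have "x \<notin> S" using assms by auto
  then show "signed_sum (insert x I) a S = signed_sum I a S - a x"
    using assms by (simp add: signed_sum_def)
  have "(\<Sum>y\<in>I. if y \<in> insert x S then a y else - a y) = signed_sum I a S"
    unfolding signed_sum_def using assms(2) by (intro sum.cong) auto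
  then show "signed_sum (insert x I) a (insert x S) = signed_sum I a S + a x"
    using assms by (simp add: signed_sum_def)
qed

text \<open>Splitting on the sign of \<open>x\<close> moves \<open>a x\<close> into the offset
  \<open>b\<close>. The moment bounds carry an arbitrary \<open>b\<close> so that they can be proved
  by this recursion.\<close>

lemma sum_Pow_insert_signed_sum:
  assumes "finite I" "x \<notin> I"
  shows "(\<Sum>S\<in>Pow (insert x I). f (b + signed_sum (insert x I) a S)) =
    (\<Sum>S\<in>Pow I. f (b - a x + signed_sum I a S)) + (\<Sum>S\<in>Pow I. f (b + a x + signed_sum I a S))"
proof -
  have "(\<Sum>S\<in>Pow (insert x I). f (b + signed_sum (insert x I) a S)) =
    (\<Sum>S\<in>Pow I. f (b - a x + signed_sum I a S) + f (b + a x + signed_sum I a S))"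
    unfolding sum_Pow_insert[OF assms]
    by (intro sum.cong) (use assms in \<open>auto simp: signed_sum_insert algebra_simps\<close>)
  then show ?thesis by (simp add: sum.distrib)
qed

lemma signed_sum_second_moment:
  assumes "finite I"
  shows "(\<Sum>S\<in>Pow I. (b + signed_sum I a S)\<^sup>2) = 2 ^ card I * (b\<^sup>2 + (\<Sum>x\<in>I. (a x)\<^sup>2))"
  using assms
proof (induction I arbitrary: b rule: finite_induct)
  case empty
  then show ?case by (simp add: signed_sum_def)
next
  case (insert x I)
  show ?case
    unfolding sum_Pow_insert_signed_sum[OF insert.hyps, where f = "\<lambda>z. z\<^sup>2"] insert.IH
    using insert.hyps by (simp add: power2_eq_square algebra_simps)
qed

text \<open>The coefficient 6 is the exact one: with the weaker bound \<open>3 (b\<^sup>2 + V)\<^sup>2\<close>, which is all that is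
  needed later, the induction over the index set would not close.\<close>
lemma signed_sum_fourth_moment:
  assumes "finite I"
  shows "(\<Sum>S\<in>Pow I. (b + signed_sum I a S) ^ 4) \<le>
    2 ^ card I * (b ^ 4 + 6 * b\<^sup>2 * (\<Sum>x\<in>I. (a x)\<^sup>2) + 3 * (\<Sum>x\<in>I. (a x)\<^sup>2)\<^sup>2)"
  using assms
proof (induction I arbitrary: b rule: finite_induct)
  case empty
  then show ?case by (simp add: signed_sum_def)
next
  case (insert x I)
  define V where "V = (\<Sum>x\<in>I. (a x)\<^sup>2)"
  define m where "m b = b ^ 4 + 6 * b\<^sup>2 * V + 3 * V\<^sup>2" for b
  have "(\<Sum>S\<in>Pow (insert x I). (b + signed_sum (insert x I) a S) ^ 4) \<le>
      2 ^ card I * m (b - a x) + 2 ^ card I * m (b + a x)"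
    unfolding sum_Pow_insert_signed_sum[OF insert.hyps, where f = "\<lambda>z. z ^ 4"] m_def V_def
    by (intro add_mono insert.IH)
  also have "\<dots> = 2 ^ card I * (m (b - a x) + m (b + a x))"
    by (simp add: algebra_simps)
  also have "m (b - a x) + m (b + a x) \<le>
      2 * (b ^ 4 + 6 * b\<^sup>2 * ((a x)\<^sup>2 + V) + 3 * ((a x)\<^sup>2 + V)\<^sup>2)"
  proof -
    have "2 * (b ^ 4 + 6 * b\<^sup>2 * ((a x)\<^sup>2 + V) + 3 * ((a x)\<^sup>2 + V)\<^sup>2) - (m (b - a x) + m (b + a x))
        = 4 * a x ^ 4"
      unfolding m_def by (simp add: power2_eq_square power4_eq_xxxx algebra_simps)
    moreover have "0 \<le> a x ^ 4" by simp
    ultimately show ?thesis by linarith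
  qed
  finally show ?case
    using insert.hyps by (simp add: V_def mult_left_mono algebra_simps)
qed

text \<open>An even polynomial minorant of the truncated absolute value: its expectation needs only
  the second and fourth moments.\<close>

lemma quartic_le_min:
  fixes z :: real
  shows "z\<^sup>2 - z ^ 4 / 4 \<le> min 1 \<bar>z\<bar>"
proof -
  define w where "w = \<bar>z\<bar>"
  have z: "z\<^sup>2 = w\<^sup>2" "z ^ 4 = w ^ 4" "0 \<le> w"
    by (simp_all add: w_def power_even_abs)
  have "1 - (w\<^sup>2 - w ^ 4 / 4) = (1 - w\<^sup>2 / 2)\<^sup>2"
    by (simp add: power2_eq_square power4_eq_xxxx algebra_simps)
  also have "\<dots> \<ge> 0" by simp
  finally have 1: "w\<^sup>2 - w ^ 4 / 4 \<le> 1" by simp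
  \<comment> \<open>The cofactor of \<open>w / 4\<close> is w^3 - 4w + 4. It is positive for
    \<open>w\<close> at least 0, and 6/5 is a rational point near its minimum at sqrt(4/3).\<close>
  have "w - (w\<^sup>2 - w ^ 4 / 4) =
      w / 4 * ((w - 6/5)\<^sup>2 * (w + 12/5) + 8/25 * w + 68/125)"
    by (simp add: power2_eq_square power4_eq_xxxx field_simps)
  also have "\<dots> \<ge> 0"
    using z(3) by (intro mult_nonneg_nonneg add_nonneg_nonneg) auto
  finally have "w\<^sup>2 - w ^ 4 / 4 \<le> w" by simp
  with 1 show ?thesis unfolding z w_def[symmetric] by simp
qed

text \<open>Normalised to second moment 1, the affine form has fourth moment at most 3, so
  \<open>quartic_le_min\<close> gives at least 1 - 3/4 = 1/4 on average. The truncation at 1 is kept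
  because the distance of product measures saturates as well.\<close>

lemma truncated_khintchine:
  fixes r B b :: real
  assumes "finite I" and "0 \<le> r" "r \<le> 1" "0 \<le> B"
    and r: "r\<^sup>2 \<le> B\<^sup>2 * (b\<^sup>2 + (\<Sum>x\<in>I. (a x)\<^sup>2))"
  shows "2 ^ card I * (r / 4) \<le> (\<Sum>S\<in>Pow I. min 1 (B * \<bar>b + signed_sum I a S\<bar>))"
proof (cases "r = 0")
  case True
  then show ?thesis using \<open>0 \<le> B\<close> by (auto intro!: sum_nonneg)
next
  case False
  define V where "V = (\<Sum>x\<in>I. (a x)\<^sup>2)"
  define s where "s = b\<^sup>2 + V"
  have "V \<ge> 0" unfolding V_def by (intro sum_nonneg) simp
  have "s \<noteq> 0" using r False by (auto simp: s_def V_def)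
  then have s: "s > 0" using \<open>V \<ge> 0\<close> by (simp add: s_def order_less_le)
  have "r \<le> sqrt (B\<^sup>2 * s)"
    using r by (intro real_le_rsqrt) (simp add: s_def V_def)
  then have rB: "r / sqrt s \<le> B"
    using \<open>0 \<le> B\<close> s by (simp add: real_sqrt_mult pos_divide_le_eq)
  \<comment> \<open>Rescaling by \<open>sqrt s\<close> costs the factor \<open>r\<close>: both
    \<open>r \<le> 1\<close> and \<open>r / sqrt s \<le> B\<close> hold, so each argument of the
    minimum dominates.\<close>
  have point: "r * (z\<^sup>2 / s - z ^ 4 / (4 * s\<^sup>2)) \<le> min 1 (B * \<bar>z\<bar>)" for z
  proof -
    have "sqrt s ^ 4 = s\<^sup>2"
      using s by (simp add: power4_eq_xxxx power2_eq_square)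
    then have "z\<^sup>2 / s - z ^ 4 / (4 * s\<^sup>2) \<le> min 1 \<bar>z / sqrt s\<bar>"
      using quartic_le_min[of "z / sqrt s"] s by (simp add: power_divide mult.commute)
    then have "r * (z\<^sup>2 / s - z ^ 4 / (4 * s\<^sup>2)) \<le> r * min 1 \<bar>z / sqrt s\<bar>"
      using \<open>0 \<le> r\<close> by (rule mult_left_mono)
    also have "\<dots> = min r (r / sqrt s * \<bar>z\<bar>)"
      using \<open>0 \<le> r\<close> s by (simp add: min_mult_distrib_left abs_divide)
    also have "\<dots> \<le> min 1 (B * \<bar>z\<bar>)"
      using \<open>r \<le> 1\<close> rB by (intro min.mono mult_right_mono) auto
    finally show ?thesis .
  qed
  define Z where "Z S = b + signed_sum I a S" for S
  have m2: "(\<Sum>S\<in>Pow I. (Z S)\<^sup>2) = 2 ^ card I * s"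
    unfolding Z_def s_def V_def by (rule signed_sum_second_moment[OF assms(1)])
  have "(\<Sum>S\<in>Pow I. (Z S) ^ 4) \<le> 2 ^ card I * (b ^ 4 + 6 * b\<^sup>2 * V + 3 * V\<^sup>2)"
    unfolding Z_def V_def by (rule signed_sum_fourth_moment[OF assms(1)])
  also have "b ^ 4 + 6 * b\<^sup>2 * V + 3 * V\<^sup>2 = 3 * s\<^sup>2 - 2 * b ^ 4"
    by (simp add: s_def power2_eq_square power4_eq_xxxx algebra_simps)
  also have "\<dots> \<le> 3 * s\<^sup>2" by simp
  finally have m4: "(\<Sum>S\<in>Pow I. (Z S) ^ 4) \<le> 2 ^ card I * (3 * s\<^sup>2)" by simp
  have "2 ^ card I * (r / 4) = r * (2 ^ card I * s / s - 2 ^ card I * (3 * s\<^sup>2) / (4 * s\<^sup>2))"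
    using s by (simp add: field_simps)
  also have "\<dots> \<le> r * ((\<Sum>S\<in>Pow I. (Z S)\<^sup>2) / s - (\<Sum>S\<in>Pow I. (Z S) ^ 4) / (4 * s\<^sup>2))"
    unfolding m2 using m4 \<open>0 \<le> r\<close> s
    by (intro mult_left_mono diff_left_mono divide_right_mono) auto
  also have "\<dots> = (\<Sum>S\<in>Pow I. r * ((Z S)\<^sup>2 / s - (Z S) ^ 4 / (4 * s\<^sup>2)))"
    by (simp add: sum_subtractf sum_divide_distrib[symmetric] sum_distrib_left[symmetric])
  also have "\<dots> \<le> (\<Sum>S\<in>Pow I. min 1 (B * \<bar>Z S\<bar>))"
    by (intro sum_mono point)
  finally show ?thesis by (simp add: Z_def)
qed

section \<open>Distance between product distributions\<close>

lemma finite_tuples: "finite A \<Longrightarrow> finite (tuples T A)"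
  unfolding tuples_def by (rule finite_lists_length_eq)

lemma sum_tuples_prod_list:
  fixes f :: "'a \<Rightarrow> 'b :: comm_semiring_1"
  shows "(\<Sum>xs\<in>tuples T A. prod_list (map f xs)) = (\<Sum>x\<in>A. f x) ^ T"
proof (induction T)
  case 0
  have "tuples 0 A = {[]}" by (auto simp: tuples_def)
  then show ?case by simp
next
  case (Suc T)
  have "tuples (Suc T) A = (\<lambda>(xs, x). x # xs) ` (tuples T A \<times> A)"
    unfolding tuples_def by (rule lists_length_Suc_eq)
  then have "(\<Sum>xs\<in>tuples (Suc T) A. prod_list (map f xs)) =
      (\<Sum>(xs, x)\<in>tuples T A \<times> A. f x * prod_list (map f xs))"
    by (simp add: sum.reindex inj_on_def case_prod_unfold)
  also have "\<dots> = (\<Sum>x\<in>A. f x) * (\<Sum>xs\<in>tuples T A. prod_list (map f xs))"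
    by (simp add: sum_product sum.cartesian_product[symmetric] sum.swap[of _ A])
  finally show ?case by (simp add: Suc.IH)
qed

text \<open>The binomial terms of degree at least 2 have nonnegative coefficients, so the triangle
  inequality bounds them by the same terms at \<open>norm z\<close>.\<close>

lemma norm_power_diff_linear_le:
  fixes z :: complex
  shows "norm ((1 + z) ^ n - 1 - of_nat n * z) \<le> (1 + norm z) ^ n - 1 - real n * norm z"
proof (induction n)
  case 0
  then show ?case by simp
next
  case (Suc n)
  have ge: "1 + real n * norm z \<le> (1 + norm z) ^ n"
    by (rule Bernoulli_inequality) (smt (verit) norm_ge_zero)
  have "(1 + z) ^ Suc n - 1 - of_nat (Suc n) * z =
      (1 + z) * ((1 + z) ^ n - 1 - of_nat n * z) + of_nat n * z\<^sup>2"
    by (simp add: power2_eq_square algebra_simps)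
  also have "norm \<dots> \<le> norm (1 + z) * norm ((1 + z) ^ n - 1 - of_nat n * z) + real n * (norm z)\<^sup>2"
    by (rule norm_triangle_le) (simp add: norm_mult norm_power)
  also have "\<dots> \<le> (1 + norm z) * ((1 + norm z) ^ n - 1 - real n * norm z) + real n * (norm z)\<^sup>2"
    using Suc.IH ge norm_triangle_ineq[of 1 z]
    by (intro add_right_mono mult_mono) auto
  also have "\<dots> = (1 + norm z) ^ Suc n - 1 - real (Suc n) * norm z"
    by (simp add: power2_eq_square algebra_simps)
  finally show ?case .
qed

text \<open>With x = n * norm z, the linear term has norm x and the remaining terms at most x^2,
  hence at most x/2 in this range.\<close>

lemma norm_power_diff_one_ge:
  fixes z :: complex
  assumes "real n * norm z \<le> 1 / 2"
  shows "real n * norm z / 2 \<le> norm ((1 + z) ^ n - 1)"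
proof -
  define x where "x = real n * norm z"
  have x: "0 \<le> x" "x \<le> 1 / 2" using assms by (auto simp: x_def)
  have "(1 + norm z) ^ n \<le> exp (norm z) ^ n"
    by (intro power_mono) auto
  also have "\<dots> = exp x" by (simp add: x_def exp_of_nat_mult)
  also have "\<dots> \<le> 1 + x + x\<^sup>2" using x by (intro exp_bound) auto
  finally have "norm ((1 + z) ^ n - 1 - of_nat n * z) \<le> x\<^sup>2"
    using norm_power_diff_linear_le[of z n] by (simp add: x_def)
  moreover have "x \<le> norm ((1 + z) ^ n - 1) + norm ((1 + z) ^ n - 1 - of_nat n * z)"
    using norm_triangle_ineq4[of "(1 + z) ^ n - 1" "(1 + z) ^ n - 1 - of_nat n * z"]
    by (simp add: x_def norm_mult)
  moreover have "x\<^sup>2 \<le> x / 2"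
    using x mult_left_mono[of x "1/2" x] by (simp add: power2_eq_square)
  ultimately show ?thesis by (simp add: x_def)
qed

lemma norm_prod_list_le_1:
  fixes g :: "'a \<Rightarrow> complex"
  assumes "\<And>x. x \<in> set xs \<Longrightarrow> norm (g x) \<le> 1"
  shows "norm (prod_list (map g xs)) \<le> 1"
  using assms by (induction xs) (auto simp: norm_mult intro: mult_le_one)

lemma prod_list_map_mult:
  fixes f g :: "'a \<Rightarrow> 'b :: comm_monoid_mult"
  shows "prod_list (map (\<lambda>x. f x * g x) xs) = prod_list (map f xs) * prod_list (map g xs)"
  by (induction xs) (auto simp: mult_ac)

lemma prod_list_of_real:
  "prod_list (map (\<lambda>x. complex_of_real (f x)) xs) = complex_of_real (prod_list (map f xs))"
  by (induction xs) auto

text \<open>The test function is the product of the factors \<open>\<alpha> + \<i>\<beta>v(y\<^sub>i)\<close> with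
  \<open>\<alpha>\<^sup>2 + \<beta>\<^sup>2 = 1\<close> and \<open>\<beta>/\<alpha> = T\<^sup>-\<^sup>1\<^sup>/\<^sup>2\<close>: it is bounded by 1, and its expectations under the two
  product measures are \<open>(\<alpha> + \<i>\<beta>\<delta>)\<^sup>T\<close> and \<open>\<alpha>\<^sup>T\<close>.\<close>
lemma product_l1_dist_ge_test:
  fixes q u v :: "'a \<Rightarrow> real"
  assumes "T > 0" and q: "sum q A = 1" and u: "sum u A = 1"
    and v: "\<And>y. y \<in> A \<Longrightarrow> \<bar>v y\<bar> \<le> 1" and uv: "(\<Sum>y\<in>A. u y * v y) = 0"
    and \<delta>: "\<delta> = (\<Sum>y\<in>A. q y * v y)" "sqrt T * \<bar>\<delta>\<bar> \<le> 1 / 2"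
  shows "sqrt T * \<bar>\<delta>\<bar> / 4 \<le>
    (\<Sum>ys\<in>tuples T A. \<bar>prod_list (map q ys) - prod_list (map u ys)\<bar>)"
proof -
  define \<alpha> where "\<alpha> = sqrt (T / (T + 1))"
  define \<beta> where "\<beta> = sqrt (1 / (T + 1))"
  \<comment> \<open>Adding an imaginary part of relative size at most \<open>1 / sqrt T\<close>
    raises the modulus by a factor of at most \<open>sqrt (1 + 1 / T)\<close>, a constant after
    \<open>T\<close> factors. A real perturbation of that size could cost as much as exp(sqrt
    T).\<close>
  define g where "g y = Complex \<alpha> (\<beta> * v y)" for y
  have \<alpha>: "\<alpha> > 0" using \<open>T > 0\<close> by (simp add: \<alpha>_def)
  have ab: "\<alpha>\<^sup>2 + \<beta>\<^sup>2 = 1" using \<open>T > 0\<close> by (simp add: \<alpha>_def \<beta>_def field_simps)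
  have \<beta>: "\<beta> = \<alpha> / sqrt T" using \<open>T > 0\<close> by (simp add: \<alpha>_def \<beta>_def real_sqrt_divide)
  have g1: "norm (g y) \<le> 1" if "y \<in> A" for y
  proof -
    have "(v y)\<^sup>2 \<le> 1" using v[OF that] by (simp add: abs_square_le_1)
    then have "\<beta>\<^sup>2 * (v y)\<^sup>2 \<le> \<beta>\<^sup>2" by (simp add: mult_left_le)
    then show ?thesis using ab by (simp add: g_def cmod_def power_mult_distrib)
  qed
  have expect: "(\<Sum>y\<in>A. complex_of_real (f y) * g y) =
      Complex (\<alpha> * sum f A) (\<beta> * (\<Sum>y\<in>A. f y * v y))" for f
    unfolding g_def by (rule complex_eqI) (simp_all add: sum_distrib_left algebra_simps)
  have prod: "(\<Sum>ys\<in>tuples T A. complex_of_real (prod_list (map f ys)) * prod_list (map g ys)) =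
      (\<Sum>y\<in>A. complex_of_real (f y) * g y) ^ T" for f
    unfolding sum_tuples_prod_list[symmetric] prod_list_map_mult prod_list_of_real ..
  define z where "z = Complex 0 (\<delta> / sqrt T)"
  have "norm z = \<bar>\<delta>\<bar> / sqrt T"
    by (simp add: z_def cmod_def power_divide real_sqrt_divide)
  then have Tz: "real T * norm z = sqrt T * \<bar>\<delta>\<bar>"
    using real_div_sqrt[of T] by (metis of_nat_0_le_iff times_divide_eq_right times_divide_eq_left mult.commute)
  \<comment> \<open>This is the price of normalising the test function to modulus at most 1: (1 +
    1/T)^T is at most e.\<close>
  have "1 / 4 \<le> (real T / (T + 1)) ^ T"
  proof -
    have "(1 + 1 / real T) ^ T \<le> exp (1 / real T) ^ T"
      by (intro power_mono) auto
    also have "\<dots> = exp 1" using \<open>T > 0\<close> by (simp flip: exp_of_nat_mult)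
    also have "\<dots> \<le> 4" using exp_le by simp
    finally have "inverse 4 \<le> inverse ((1 + 1 / real T) ^ T)"
      by (intro le_imp_inverse_le) (auto intro!: zero_less_power add_pos_nonneg)
    also have "\<dots> = (real T / (T + 1)) ^ T"
      using \<open>T > 0\<close> by (simp add: power_inverse[symmetric] inverse_eq_divide field_simps)
    finally show ?thesis by simp
  qed
  also have "real T / (T + 1) = \<alpha>\<^sup>2" by (simp add: \<alpha>_def)
  also have "(\<alpha>\<^sup>2) ^ T = (\<alpha> ^ T)\<^sup>2" by (metis power_mult mult.commute)
  finally have "(1 / 2)\<^sup>2 \<le> (\<alpha> ^ T)\<^sup>2" by (simp add: power_divide)
  then have \<alpha>T: "1 / 2 \<le> \<alpha> ^ T"
    by (rule power2_le_imp_le) (use \<alpha> in simp)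
  have "sqrt T * \<bar>\<delta>\<bar> / 4 = 1 / 2 * (real T * norm z / 2)"
    by (simp add: Tz)
  also have "\<dots> \<le> \<alpha> ^ T * norm ((1 + z) ^ T - 1)"
    using \<delta>(2) \<alpha>T \<alpha> by (intro mult_mono norm_power_diff_one_ge) (auto simp: Tz)
  also have "\<dots> = norm ((complex_of_real \<alpha> * (1 + z)) ^ T - complex_of_real \<alpha> ^ T)"
  proof -
    have "(complex_of_real \<alpha> * (1 + z)) ^ T - complex_of_real \<alpha> ^ T =
      complex_of_real \<alpha> ^ T * ((1 + z) ^ T - 1)" by (simp only: power_mult_distrib right_diff_distrib mult_1_right)
    then show ?thesis using \<alpha> by (simp add: norm_mult norm_power)
  qed
  also have "complex_of_real \<alpha> * (1 + z) = (\<Sum>y\<in>A. complex_of_real (q y) * g y)"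
    unfolding expect q \<delta>(1)[symmetric] z_def \<beta> by (rule complex_eqI) simp_all
  also have "complex_of_real \<alpha> = (\<Sum>y\<in>A. complex_of_real (u y) * g y)"
    unfolding expect u uv by (rule complex_eqI) simp_all
  also have "norm ((\<Sum>y\<in>A. complex_of_real (q y) * g y) ^ T -
      (\<Sum>y\<in>A. complex_of_real (u y) * g y) ^ T) =
    norm (\<Sum>ys\<in>tuples T A. complex_of_real (prod_list (map q ys) - prod_list (map u ys))
      * prod_list (map g ys))"
    unfolding prod[symmetric] by (simp add: sum_subtractf algebra_simps)
  also have "\<dots> \<le> (\<Sum>ys\<in>tuples T A. \<bar>prod_list (map q ys) - prod_list (map u ys)\<bar>)"
  proof (intro sum_norm_le)
    fix ys assume "ys \<in> tuples T A"
    then have "norm (prod_list (map g ys)) \<le> 1"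
      by (intro norm_prod_list_le_1 g1) (auto simp: tuples_def)
    then show "norm (complex_of_real (prod_list (map q ys) - prod_list (map u ys))
      * prod_list (map g ys)) \<le> \<bar>prod_list (map q ys) - prod_list (map u ys)\<bar>"
      unfolding norm_mult norm_of_real by (intro mult_left_le) auto
  qed
  finally show ?thesis .
qed

text \<open>The test \<open>v\<close> comes from the sign of the deviation \<open>d\<close>.
  Subtracting \<open>m\<close> makes it centred under the uniform distribution and changes nothing
  against \<open>d\<close>, which sums to 0. Halving restores the bound 1, and \<tau> damps the test
  when \<open>sqrt T * D\<close> exceeds 1, as \<open>product_l1_dist_ge_test\<close>
  demands.\<close>

lemma product_l1_dist_uniform_ge:
  fixes q :: "'a \<Rightarrow> real"
  assumes "finite A" "A \<noteq> {}" "T > 0" and q: "sum q A = 1"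
  shows "min 1 (sqrt T * (\<Sum>y\<in>A. \<bar>q y - 1 / card A\<bar>)) / 8 \<le>
    (\<Sum>ys\<in>tuples T A. \<bar>prod_list (map q ys) - (1 / card A) ^ T\<bar>)"
proof -
  define d where "d y = q y - 1 / card A" for y
  define D where "D = (\<Sum>y\<in>A. \<bar>d y\<bar>)"
  define m where "m = (\<Sum>y\<in>A. sgn (d y)) / card A"
  define \<tau> where "\<tau> = min 1 (1 / (sqrt T * D))"
  define v where "v y = \<tau> * ((sgn (d y) - m) / 2)" for y
  have A: "card A > 0" using assms by (simp add: card_gt_0_iff)
  have u: "(\<Sum>y\<in>A. 1 / real (card A)) = 1" using A by simp
  have d0: "sum d A = 0" using q u by (simp add: d_def sum_subtractf)
  have D: "D \<ge> 0" by (simp add: D_def sum_nonneg)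
  show ?thesis
  proof (cases "D = 0")
    case True
    then show ?thesis by (simp add: D_def d_def sum_nonneg)
  next
    case False
    with D have D: "D > 0" by simp
    have \<tau>: "0 \<le> \<tau>" "\<tau> \<le> 1" using D by (auto simp: \<tau>_def)
    have "\<bar>\<Sum>y\<in>A. sgn (d y)\<bar> \<le> (\<Sum>y\<in>A. 1)"
      by (intro order.trans[OF sum_abs] sum_mono) (simp add: sgn_if)
    then have m: "\<bar>m\<bar> \<le> 1" using A by (simp add: m_def abs_divide)
    have v1: "\<bar>v y\<bar> \<le> 1" for y
    proof -
      have "\<bar>(sgn (d y) - m) / 2\<bar> \<le> 1" using m by (simp add: sgn_if abs_if split: if_splits)
      then have "\<bar>\<tau>\<bar> * \<bar>(sgn (d y) - m) / 2\<bar> \<le> 1" using \<tau> by (intro mult_le_one) auto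
      then show ?thesis by (simp only: v_def abs_mult)
    qed
    have v0: "(\<Sum>y\<in>A. v y) = 0"
      using A by (simp add: v_def m_def sum_distrib_left[symmetric] sum_subtractf
          sum_divide_distrib[symmetric])
    have dv: "(\<Sum>y\<in>A. q y * v y) = \<tau> * D / 2"
    proof -
      have "(\<Sum>y\<in>A. q y * v y) = (\<Sum>y\<in>A. d y * v y)"
        using v0 by (simp add: d_def left_diff_distrib sum_subtractf sum_divide_distrib[symmetric])
      also have "\<dots> = (\<Sum>y\<in>A. (\<tau> / 2) * \<bar>d y\<bar> - (\<tau> / 2 * m) * d y)"
        by (intro sum.cong) (auto simp: v_def abs_sgn field_simps)
      also have "\<dots> = \<tau> * D / 2"
        by (simp add: sum_subtractf flip: sum_distrib_left sum_divide_distrib) (simp add: D_def d0)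
      finally show ?thesis .
    qed
    have eq: "sqrt T * \<bar>\<tau> * D / 2\<bar> = min 1 (sqrt T * D) / 2"
    proof -
      have "sqrt T * D > 0" using D \<open>T > 0\<close> by simp
      then have "\<tau> * (sqrt T * D) = min 1 (sqrt T * D)"
        unfolding \<tau>_def by (simp add: min_def field_simps)
      then show ?thesis using \<tau> D by (simp add: mult_ac)
    qed
    have "sqrt T * \<bar>\<tau> * D / 2\<bar> / 4 \<le> (\<Sum>ys\<in>tuples T A. \<bar>prod_list (map q ys) -
        prod_list (map (\<lambda>_. 1 / real (card A)) ys)\<bar>)"
      by (rule product_l1_dist_ge_test[where v = v])
         (use assms u v0 v1 dv eq in \<open>auto simp: sum_divide_distrib[symmetric]\<close>)
    also have "\<dots> = (\<Sum>ys\<in>tuples T A. \<bar>prod_list (map q ys) - (1 / card A) ^ T\<bar>)"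
      by (intro sum.cong) (auto simp: tuples_def map_replicate_const)
    finally show ?thesis unfolding eq by (simp add: D_def d_def)
  qed
qed

text \<open>The event where \<open>p\<close> is at least \<open>q\<close> collects the positive part
  of the difference, which is half of the l1 norm since both masses are 1.\<close>

lemma sum_abs_pmf_diff_le_stat_dist:
  assumes "finite \<Omega>" and p: "set_pmf p \<subseteq> \<Omega>" and q: "set_pmf q \<subseteq> \<Omega>"
  shows "(\<Sum>\<omega>\<in>\<Omega>. \<bar>pmf p \<omega> - pmf q \<omega>\<bar>) \<le> 2 * stat_dist p q"
proof -
  define S where "S = {\<omega>\<in>\<Omega>. pmf q \<omega> \<le> pmf p \<omega>}"
  have S: "finite S" "S \<subseteq> \<Omega>" using assms(1) by (auto simp: S_def)
  have "(\<Sum>\<omega>\<in>\<Omega>. \<bar>pmf p \<omega> - pmf q \<omega>\<bar>) =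
      (\<Sum>\<omega>\<in>\<Omega>. 2 * (if \<omega> \<in> S then pmf p \<omega> - pmf q \<omega> else 0) - (pmf p \<omega> - pmf q \<omega>))"
    by (intro sum.cong) (auto simp: S_def)
  also have "\<dots> = 2 * (\<Sum>\<omega>\<in>S. pmf p \<omega> - pmf q \<omega>) - (sum (pmf p) \<Omega> - sum (pmf q) \<Omega>)"
    using assms(1) S unfolding sum_subtractf
    by (simp add: sum_distrib_left[symmetric] sum.inter_restrict[symmetric] Int_absorb1 sum_subtractf)
  also have "\<dots> = 2 * (measure_pmf.prob p S - measure_pmf.prob q S)"
    using assms S by (simp add: sum_pmf_eq_1 measure_measure_pmf_finite sum_subtractf)
  also have "measure_pmf.prob p S - measure_pmf.prob q S \<le> stat_dist p q"
    unfolding stat_dist_def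
  proof (rule cSUP_upper2[where x = S])
    show "bdd_above (range (\<lambda>S. \<bar>measure_pmf.prob p S - measure_pmf.prob q S\<bar>))"
    proof (intro bdd_aboveI2[where M = 1])
      fix S
      show "\<bar>measure_pmf.prob p S - measure_pmf.prob q S\<bar> \<le> 1"
        using measure_pmf.prob_le_1[of p S] measure_pmf.prob_le_1[of q S]
          measure_nonneg[of p S] measure_nonneg[of q S] by linarith
    qed
  qed auto
  finally show ?thesis by simp
qed

section \<open>Independent blocks\<close>

lemma pmf_replicate_pmf:
  "pmf (replicate_pmf T p) xs = (if length xs = T then prod_list (map (pmf p) xs) else 0)"
proof (induction T arbitrary: xs)
  case 0
  then show ?case by (auto simp: pmf_return)
next
  case (Suc T)
  have eq: "replicate_pmf (Suc T) p = map_pmf (\<lambda>(x, xs). x # xs) (pair_pmf p (replicate_pmf T p))"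
    by (simp add: pair_pmf_def map_bind_pmf bind_return_pmf)
  show ?case
  proof (cases xs)
    case Nil
    have "[] \<notin> set_pmf (replicate_pmf (Suc T) p)" by (auto simp: set_replicate_pmf)
    then show ?thesis using Nil by (simp add: set_pmf_iff del: replicate_pmf.simps)
  next
    case (Cons x ys)
    have "pmf (replicate_pmf (Suc T) p) ((\<lambda>(x, xs). x # xs) (x, ys)) = pmf p x * pmf (replicate_pmf T p) ys"
      unfolding eq by (subst pmf_map_inj') (auto simp: inj_def pmf_pair)
    then show ?thesis using Suc.IH Cons by simp
  qed
qed

lemma map_replicate_pmf: "map_pmf (map f) (replicate_pmf T p) = replicate_pmf T (map_pmf f p)"
proof (induction T)
  case 0
  then show ?case by simp
next
  case (Suc T)
  have "map_pmf (map f) (replicate_pmf (Suc T) p) =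
      bind_pmf p (\<lambda>x. bind_pmf (map_pmf (map f) (replicate_pmf T p)) (\<lambda>xs. return_pmf (f x # xs)))"
    by (simp add: map_bind_pmf bind_map_pmf)
  also have "\<dots> = replicate_pmf (Suc T) (map_pmf f p)"
    unfolding Suc.IH by (simp add: bind_map_pmf)
  finally show ?case .
qed

lemma map_take_nth_replicate_pmf:
  assumes "i < T"
  shows "map_pmf (\<lambda>xs. (take i xs, xs ! i)) (replicate_pmf T p) = pair_pmf (replicate_pmf i p) p"
  using assms
proof (induction i arbitrary: T)
  case 0
  then obtain T' where "T = Suc T'" by (cases T) auto
  then show ?case
    by (simp add: map_bind_pmf bind_return_pmf pair_pmf_def map_pmf_def bind_assoc_pmf)
next
  case (Suc i)
  then obtain T' where T: "T = Suc T'" "i < T'" by (cases T) auto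
  have "map_pmf (\<lambda>xs. (take (Suc i) xs, xs ! Suc i)) (replicate_pmf T p) =
      bind_pmf p (\<lambda>x. map_pmf (\<lambda>(ys, y). (x # ys, y))
        (map_pmf (\<lambda>xs. (take i xs, xs ! i)) (replicate_pmf T' p)))"
    unfolding T by (simp add: map_bind_pmf bind_return_pmf map_pmf_def bind_assoc_pmf)
  also have "\<dots> = bind_pmf p (\<lambda>x. map_pmf (\<lambda>(ys, y). (x # ys, y)) (pair_pmf (replicate_pmf i p) p))"
    using Suc.IH[OF T(2)] by simp
  also have "\<dots> = pair_pmf (replicate_pmf (Suc i) p) p"
    by (simp add: pair_pmf_def map_bind_pmf bind_return_pmf map_pmf_def bind_assoc_pmf)
  finally show ?case .
qed

lemma cond_pair_pmf_fst:
  assumes "x \<in> set_pmf p"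
  shows "cond_pmf (pair_pmf p q) (fst -` {x}) = map_pmf (Pair x) q"
proof (rule pmf_eqI)
  have ne: "set_pmf (pair_pmf p q) \<inter> fst -` {x} \<noteq> {}"
    using assms set_pmf_not_empty[of q] by auto
  have m: "measure (pair_pmf p q) (fst -` {x}) = pmf p x"
    by (metis map_fst_pair_pmf pmf_map)
  have px: "pmf p x \<noteq> 0" using assms by (simp add: set_pmf_iff)
  fix ab :: "'a \<times> 'b"
  obtain a b where ab: "ab = (a, b)" by (cases ab)
  show "pmf (cond_pmf (pair_pmf p q) (fst -` {x})) ab = pmf (map_pmf (Pair x) q) ab"
  proof (cases "a = x")
    case True
    then show ?thesis using px m ne
      by (simp add: ab pmf_cond pmf_pair pmf_map_inj' inj_def)
  next
    case False
    then have "ab \<notin> set_pmf (map_pmf (Pair x) q)" by (auto simp: ab)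
    then have "pmf (map_pmf (Pair x) q) ab = 0" by (simp only: set_pmf_iff not_not)
    then show ?thesis using False ne by (simp add: ab pmf_cond)
  qed
qed

text \<open>The event constrains only the prefix. Under the map to (prefix, entry \<open>i\<close>)
  the law becomes a product, where conditioning on the first component leaves the second
  unchanged.\<close>

lemma map_nth_cond_replicate_pmf:
  assumes "i < T" and ys: "ys \<in> set_pmf (map_pmf (take i) (replicate_pmf T p))"
  shows "map_pmf (\<lambda>xs. xs ! i) (cond_pmf (replicate_pmf T p) {xs. take i xs = ys}) = p"
proof -
  let ?X = "replicate_pmf T p" and ?f = "\<lambda>xs. (take i xs, xs ! i)"
  note f = map_take_nth_replicate_pmf[OF assms(1)]
  have "map_pmf (take i) ?X = map_pmf fst (map_pmf ?f ?X)"
    by (simp add: pmf.map_comp o_def)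
  then have ys': "ys \<in> set_pmf (replicate_pmf i p)"
    using ys unfolding f map_fst_pair_pmf by simp
  have "map_pmf (\<lambda>xs. xs ! i) (cond_pmf ?X {xs. take i xs = ys}) =
      map_pmf snd (map_pmf ?f (cond_pmf ?X (?f -` (fst -` {ys}))))"
    by (simp add: pmf.map_comp o_def vimage_def)
  also have "map_pmf ?f (cond_pmf ?X (?f -` (fst -` {ys}))) =
      cond_pmf (map_pmf ?f ?X) (fst -` {ys})"
    using ys by (intro cond_map_pmf[symmetric]) auto
  also have "\<dots> = map_pmf (Pair ys) p"
    unfolding f by (rule cond_pair_pmf_fst[OF ys'])
  finally show ?thesis by (simp add: pmf.map_comp o_def)
qed

lemma block_source_replicate_pmf:
  assumes "set_pmf p \<subseteq> A" "collision_prob p \<le> 1 / real K"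
  shows "block_source K T A (replicate_pmf T p)"
  unfolding block_source_def
  using assms by (auto simp: map_nth_cond_replicate_pmf tuples_def set_replicate_pmf)

section \<open>Random perturbations of a uniform distribution\<close>

text \<open>The weights are 3 on \<open>S\<close> and 1 on the rest of \<open>I\<close>, so that, unlike for the uniform distribution
  on \<open>S\<close>, the collision probability is \<open>O(1 / |I|)\<close> for every choice of \<open>S\<close>.\<close>
definition perturbed_uniform :: "'a set \<Rightarrow> 'a set \<Rightarrow> 'a pmf" where
  "perturbed_uniform I S = pmf_of_multiset (mset_set I + mset_set S + mset_set S)"

context
  fixes I S :: "'a set"
  assumes I: "finite I" "I \<noteq> {}" and S: "S \<subseteq> I"
begin

lemma pmf_perturbed_uniform:
  "pmf (perturbed_uniform I S) x =
    of_bool (x \<in> I) * (2 + (if x \<in> S then 1 else - 1)) / (card I + 2 * card S)"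
proof -
  have "finite S" using I S finite_subset by auto
  moreover have "mset_set I + mset_set S + mset_set S \<noteq> {#}" using I by (simp add: mset_set_empty_iff)
  ultimately show ?thesis
    using I S unfolding perturbed_uniform_def
    by (subst pmf_of_multiset) (auto simp: count_mset_set')
qed

lemma set_pmf_perturbed_uniform: "set_pmf (perturbed_uniform I S) \<subseteq> I"
  by (auto simp: set_pmf_iff pmf_perturbed_uniform)

lemma collision_prob_perturbed_uniform: "collision_prob (perturbed_uniform I S) \<le> 9 / card I"
proof -
  have n: "real (card I) > 0" using I by (simp add: card_gt_0_iff)
  have "collision_prob (perturbed_uniform I S) = (\<Sum>\<^sub>\<infinity>x\<in>I. (pmf (perturbed_uniform I S) x)\<^sup>2)"
    unfolding collision_prob_def by (intro infsum_cong_neutral) (auto simp: pmf_perturbed_uniform)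
  also have "\<dots> = (\<Sum>x\<in>I. (pmf (perturbed_uniform I S) x)\<^sup>2)"
    using I by simp
  also have "\<dots> \<le> (\<Sum>x\<in>I. (3 / card I)\<^sup>2)"
    using n by (intro sum_mono power_mono) (auto simp: pmf_perturbed_uniform intro!: frac_le)
  also have "\<dots> = 9 / card I" using n by (simp add: power2_eq_square)
  finally show ?thesis .
qed

text \<open>Since the masses sum to 1, \<open>c\<close> can be moved inside the sum, which leaves an
  affine form in the signs times \<open>card I / W\<close>. The normalisation \<open>W\<close>
  depends on \<open>S\<close>, so this factor is replaced by its lower bound 1/3.\<close>

lemma pmf_map_perturbed_uniform_deviation:
  fixes c :: real and f :: "'a \<Rightarrow> 'b" and y :: 'b
  defines "a \<equiv> \<lambda>x. (of_bool (f x = y) - c) / card I"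
  shows "\<bar>2 * sum a I + signed_sum I a S\<bar> / 3 \<le> \<bar>pmf (map_pmf f (perturbed_uniform I S)) y - c\<bar>"
proof -
  let ?p = "perturbed_uniform I S"
  have n: "real (card I) > 0" using I by (simp add: card_gt_0_iff)
  define W where "W = real (card I + 2 * card S)"
  have W: "0 < W" "W \<le> 3 * card I"
    using n card_mono[OF I(1) S] by (auto simp: W_def)
  have "pmf (map_pmf f ?p) y = measure ?p (f -` {y} \<inter> set_pmf ?p)"
    by (simp add: pmf_map measure_Int_set_pmf)
  also have "\<dots> = measure ?p {x\<in>I. f x = y}"
    by (intro measure_prob_cong_0) (use set_pmf_perturbed_uniform in \<open>auto simp: set_pmf_iff\<close>)
  also have "\<dots> = (\<Sum>x\<in>I. if f x = y then pmf ?p x else 0)"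
    using I by (simp add: measure_measure_pmf_finite sum.inter_filter)
  also have "\<dots> = (\<Sum>x\<in>I. pmf ?p x * of_bool (f x = y))"
    by (intro sum.cong) auto
  also have "\<dots> - c * (\<Sum>x\<in>I. pmf ?p x) = (\<Sum>x\<in>I. pmf ?p x * (of_bool (f x = y) - c))"
    by (simp add: sum_distrib_left sum_subtractf algebra_simps)
  also have "(\<Sum>x\<in>I. pmf ?p x) = 1"
    using I set_pmf_perturbed_uniform by (intro sum_pmf_eq_1)
  also have "(\<Sum>x\<in>I. pmf ?p x * (of_bool (f x = y) - c)) =
      (\<Sum>x\<in>I. card I / W * (2 * a x + (if x \<in> S then a x else - a x)))"
  proof (intro sum.cong refl)
    fix x assume "x \<in> I"
    then have "pmf ?p x = (2 + (if x \<in> S then 1 else - 1)) / W"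
      by (simp add: pmf_perturbed_uniform W_def)
    moreover have "of_bool (f x = y) - c = card I * a x"
      using n by (simp add: a_def)
    ultimately show "pmf ?p x * (of_bool (f x = y) - c) =
        card I / W * (2 * a x + (if x \<in> S then a x else - a x))"
      by (simp add: algebra_simps)
  qed
  also have "\<dots> = card I / W * (2 * sum a I + signed_sum I a S)"
    unfolding signed_sum_def by (simp only: sum.distrib sum_distrib_left[symmetric])
  finally have eq: "\<bar>pmf (map_pmf f ?p) y - c\<bar> = card I / W * \<bar>2 * sum a I + signed_sum I a S\<bar>"
    using W n by (simp add: abs_mult)
  have "1 / 3 \<le> card I / W" using W n by (simp add: field_simps)
  from mult_right_mono[OF this, of "\<bar>2 * sum a I + signed_sum I a S\<bar>"]
  show ?thesis unfolding eq by simp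
qed

end

text \<open>An underfull bin already has a large bias, and otherwise the variance is large.\<close>
lemma bin_deviation_second_moment_ge:
  fixes M :: nat and f :: "'a \<Rightarrow> 'b" and y :: 'b
  assumes "finite I" "2 \<le> M" "M \<le> card I"
  defines "a \<equiv> \<lambda>x. (of_bool (f x = y) - 1 / real M) / real (card I)"
  shows "1 / (8 * real M * real (card I)) \<le> (2 * sum a I)\<^sup>2 + (\<Sum>x\<in>I. (a x)\<^sup>2)"
proof -
  define m n where "m = real M" and "n = real (card I)"
  define k where "k = real (card {x\<in>I. f x = y})"
  have mn: "2 \<le> m" "m \<le> n" "0 < m" "0 < n" using assms by (auto simp: m_def n_def)
  have k: "(\<Sum>x\<in>I. of_bool (f x = y)) = k"
    using assms(1) by (simp add: k_def of_bool_def sum.inter_filter[symmetric])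
  \<comment> \<open>The threshold is half the fair share \<open>n / m\<close>. From there on, each
    point of the bin adds at least 1/(4n^2) to the variance because \<open>m\<close> is at least 2.
    Below it, \<open>2 * sum a I\<close> is at most -1/m, and its square suffices because
    \<open>m \<le> n\<close>.\<close>
  show ?thesis
  proof (cases "n / (2 * m) \<le> k")
    case True
    have "1 / (8 * m * n) = (n / (2 * m)) / (4 * n\<^sup>2)"
      using mn by (simp add: power2_eq_square field_simps)
    also have "\<dots> \<le> k / (4 * n\<^sup>2)"
      using True mn by (intro divide_right_mono) auto
    also have "\<dots> = (\<Sum>x\<in>I. of_bool (f x = y) / (4 * n\<^sup>2))"
      by (simp add: k[symmetric] sum_divide_distrib)
    also have "\<dots> \<le> (\<Sum>x\<in>I. (a x)\<^sup>2)"
    proof (intro sum_mono)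
      fix x
      have "1 / 2 \<le> 1 - 1 / m" using mn by (simp add: field_simps)
      from power_mono[OF this, of 2] have "1 / 4 \<le> (1 - 1 / m)\<^sup>2"
        by (simp add: power2_eq_square)
      from divide_right_mono[OF this, of "n\<^sup>2"]
      show "of_bool (f x = y) / (4 * n\<^sup>2) \<le> (a x)\<^sup>2"
        by (auto simp: a_def power_divide m_def n_def)
    qed
    finally show ?thesis by (simp add: m_def n_def add_increasing)
  next
    case False
    have "sum a I = (k - n / m) / n"
      by (simp add: a_def sum_divide_distrib[symmetric] sum_subtractf k n_def m_def)
    also have "\<dots> \<le> (n / (2 * m) - n / m) / n"
      using False mn by (intro divide_right_mono) auto
    also have "\<dots> = - (1 / (2 * m))" using mn by (simp add: field_simps)
    finally have "1 / m \<le> - (2 * sum a I)" by simp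
    from power_mono[OF this, of 2] have "1 / m\<^sup>2 \<le> (2 * sum a I)\<^sup>2"
      using mn by (simp add: power_divide)
    moreover have "1 / (8 * m * n) \<le> 1 / m\<^sup>2"
      using mn by (intro divide_left_mono) (auto simp: power2_eq_square intro: mult_mono)
    moreover have "0 \<le> (\<Sum>x\<in>I. (a x)\<^sup>2)" by (simp add: sum_nonneg)
    ultimately show ?thesis by (simp add: m_def n_def)
  qed
qed

lemma sum_perturbed_uniform_deviation_ge:
  fixes M T :: nat and r :: real
  assumes "finite I" "2 \<le> M" "M \<le> card I" "0 \<le> r" "r \<le> 1"
    and r: "r\<^sup>2 \<le> real T * real M / (72 * real (card I))"
  shows "2 ^ card I * (r / 4) \<le> (\<Sum>S\<in>Pow I. min 1 (sqrt T * real M *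
    \<bar>pmf (map_pmf f (perturbed_uniform I S)) y - 1 / real M\<bar>))"
proof -
  define a where "a x = (of_bool (f x = y) - 1 / real M) / real (card I)" for x
  \<comment> \<open>The 3 is the loss from normalising the weights. Its square times the 8 of
    \<open>bin_deviation_second_moment_ge\<close> is the 72 in the assumption on
    \<open>r\<close>.\<close>
  define B where "B = sqrt T * real M / 3"
  have I: "I \<noteq> {}" using assms by auto
  have n: "real (card I) > 0" "real M > 0" using assms by auto
  have "r\<^sup>2 \<le> B\<^sup>2 * (1 / (8 * real M * real (card I)))"
    using r n by (simp add: B_def power_divide power_mult_distrib power2_eq_square field_simps)
  also have "\<dots> \<le> B\<^sup>2 * ((2 * sum a I)\<^sup>2 + (\<Sum>x\<in>I. (a x)\<^sup>2))"
    unfolding a_def using assms by (intro mult_left_mono bin_deviation_second_moment_ge) auto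
  finally have "2 ^ card I * (r / 4) \<le> (\<Sum>S\<in>Pow I. min 1 (B * \<bar>2 * sum a I + signed_sum I a S\<bar>))"
    using assms by (intro truncated_khintchine) (auto simp: B_def)
  also have "\<dots> \<le> (\<Sum>S\<in>Pow I. min 1 (sqrt T * real M *
    \<bar>pmf (map_pmf f (perturbed_uniform I S)) y - 1 / real M\<bar>))"
  proof (intro sum_mono min.mono order.refl)
    fix S assume "S \<in> Pow I"
    then have "\<bar>2 * sum a I + signed_sum I a S\<bar> / 3 \<le>
        \<bar>pmf (map_pmf f (perturbed_uniform I S)) y - 1 / real M\<bar>"
      unfolding a_def using pmf_map_perturbed_uniform_deviation[OF assms(1) I, of S f y] by simp
    from mult_left_mono[OF this, of "sqrt T * real M"]
    show "B * \<bar>2 * sum a I + signed_sum I a S\<bar> \<le> sqrt T * real M *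
        \<bar>pmf (map_pmf f (perturbed_uniform I S)) y - 1 / real M\<bar>"
      by (simp add: B_def)
  qed
  finally show ?thesis .
qed

section \<open>Distance of the hashed source from uniform\<close>

lemma pmf_hashed_source:
  "pmf (hashed_source \<H> X) (h, ys) = pmf (pmf_of_multiset \<H>) h * pmf (map_pmf (map h) X) ys"
proof -
  have "pmf (hashed_source \<H> X) (h, ys) =
      measure (pair_pmf (pmf_of_multiset \<H>) X) ({h} \<times> (map h -` {ys}))"
    unfolding hashed_source_def pmf_map by (rule arg_cong[where f = "measure _"]) auto
  also have "\<dots> = measure (pmf_of_multiset \<H>) {h} * measure X (map h -` {ys})"
    by (rule measure_pmf_prob_product) auto
  finally show ?thesis by (simp add: pmf_map measure_pmf_single)
qed

lemma card_tuples: "finite A \<Longrightarrow> card (tuples T A) = card A ^ T"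
  unfolding tuples_def by (rule card_lists_length_eq)

text \<open>Both distributions reveal \<open>h\<close>, so their l1 distance is the average over
  \<open>h\<close> of distances between product measures. The bound is split into bins so that the
  Khintchine estimate applies to each bin separately.\<close>

lemma stat_dist_hashed_replicate_pmf_ge:
  fixes \<H> :: "(nat \<Rightarrow> nat) multiset"
  assumes \<H>: "hash_family N M \<H>" and "M > 0" "T > 0" and p: "set_pmf p \<subseteq> {1..N}"
  shows "(\<Sum>h\<in>set_mset \<H>. pmf (pmf_of_multiset \<H>) h *
      (\<Sum>y\<in>{1..M}. min 1 (sqrt T * real M * \<bar>pmf (map_pmf h p) y - 1 / real M\<bar>))) / (8 * real M)
    \<le> 2 * stat_dist (hashed_source \<H> (replicate_pmf T p)) (ideal_source \<H> T M)"
    (is "?L \<le> _")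
proof -
  let ?A = "{1..M}" and ?H = "pmf_of_multiset \<H>"
  let ?P = "hashed_source \<H> (replicate_pmf T p)" and ?Q = "ideal_source \<H> T M"
  have maps: "h x \<in> ?A" if "h \<in># \<H>" "x \<in> {1..N}" for h x
    using \<H> that by (auto simp: hash_family_def PiE_def Pi_def)
  have ne: "\<H> \<noteq> {#}" using \<H> by (simp add: hash_family_def)
  have fin: "finite (tuples T ?A)" by (simp add: finite_tuples)
  have ct: "card (tuples T ?A) = M ^ T" by (simp add: card_tuples)
  have tne: "tuples T ?A \<noteq> {}" using ct \<open>M > 0\<close> by (metis card.empty power_not_zero less_numeral_extra(3))
  have Q: "pmf ?Q (h, ys) = pmf ?H h * (1 / real M) ^ T" if "ys \<in> tuples T ?A" for h ys
    using that fin tne ct by (simp add: ideal_source_def pmf_pair power_divide)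
  have P: "pmf ?P (h, ys) = pmf ?H h * prod_list (map (pmf (map_pmf h p)) ys)"
    if "ys \<in> tuples T ?A" for h ys
    using that by (simp add: pmf_hashed_source map_replicate_pmf pmf_replicate_pmf tuples_def)
  have "?L = (\<Sum>h\<in>set_mset \<H>. pmf ?H h *
      ((\<Sum>y\<in>?A. min 1 (sqrt T * real M * \<bar>pmf (map_pmf h p) y - 1 / real M\<bar>)) / (8 * real M)))"
    by (simp only: sum_divide_distrib[where A = "set_mset \<H>"] times_divide_eq_right)
  also have "\<dots> \<le> (\<Sum>h\<in>set_mset \<H>. pmf ?H h *
      (\<Sum>ys\<in>tuples T ?A. \<bar>prod_list (map (pmf (map_pmf h p)) ys) - (1 / real M) ^ T\<bar>))"
  proof (intro sum_mono mult_left_mono)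
    fix h assume h: "h \<in># \<H>"
    let ?q = "pmf (map_pmf h p)"
    \<comment> \<open>Jensen's inequality for the concave function \<open>min 1\<close>, averaged
      over the \<open>M\<close> bins.\<close>
    have "(\<Sum>y\<in>?A. min 1 (sqrt T * real M * \<bar>?q y - 1 / real M\<bar>)) \<le>
      real M * min 1 (sqrt T * (\<Sum>y\<in>?A. \<bar>?q y - 1 / real M\<bar>))"
    proof -
      have "(\<Sum>y\<in>?A. min 1 (sqrt T * real M * \<bar>?q y - 1 / real M\<bar>)) \<le> (\<Sum>y\<in>?A. 1)"
        by (intro sum_mono) simp
      moreover have "(\<Sum>y\<in>?A. min 1 (sqrt T * real M * \<bar>?q y - 1 / real M\<bar>)) \<le>
          (\<Sum>y\<in>?A. sqrt T * real M * \<bar>?q y - 1 / real M\<bar>)"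
        by (intro sum_mono) simp
      ultimately show ?thesis by (simp add: min_mult_distrib_left sum_distrib_left mult_ac)
    qed
    moreover have "a / (8 * real M) \<le> b / 8" if "a \<le> real M * b" for a b
      using that \<open>M > 0\<close> by (simp add: field_simps)
    ultimately have "(\<Sum>y\<in>?A. min 1 (sqrt T * real M * \<bar>?q y - 1 / real M\<bar>)) / (8 * real M) \<le>
      min 1 (sqrt T * (\<Sum>y\<in>?A. \<bar>?q y - 1 / real M\<bar>)) / 8"
      by blast
    also have "\<dots> \<le> (\<Sum>ys\<in>tuples T ?A. \<bar>prod_list (map ?q ys) - (1 / real M) ^ T\<bar>)"
    proof -
      have "sum ?q ?A = 1"
        using p maps[OF h] by (intro sum_pmf_eq_1) auto
      then show ?thesis
        using product_l1_dist_uniform_ge[of ?A T ?q] \<open>M > 0\<close> \<open>T > 0\<close> by simp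
    qed
    finally show "(\<Sum>y\<in>?A. min 1 (sqrt T * real M * \<bar>?q y - 1 / real M\<bar>)) / (8 * real M) \<le>
      (\<Sum>ys\<in>tuples T ?A. \<bar>prod_list (map ?q ys) - (1 / real M) ^ T\<bar>)" .
  qed simp
  also have "\<dots> = (\<Sum>h\<in>set_mset \<H>. \<Sum>ys\<in>tuples T ?A. \<bar>pmf ?P (h, ys) - pmf ?Q (h, ys)\<bar>)"
    unfolding sum_distrib_left
    by (intro sum.cong refl) (simp add: P Q right_diff_distrib[symmetric] abs_mult)
  also have "\<dots> = (\<Sum>\<omega>\<in>set_mset \<H> \<times> tuples T ?A. \<bar>pmf ?P \<omega> - pmf ?Q \<omega>\<bar>)"
    by (simp add: sum.cartesian_product case_prod_unfold)
  also have "\<dots> \<le> 2 * stat_dist ?P ?Q"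
  proof (rule sum_abs_pmf_diff_le_stat_dist)
    show "finite (set_mset \<H> \<times> tuples T ?A)" using fin by simp
    show "set_pmf ?P \<subseteq> set_mset \<H> \<times> tuples T ?A"
      using p maps ne by (fastforce simp: hashed_source_def set_replicate_pmf tuples_def)
    show "set_pmf ?Q \<subseteq> set_mset \<H> \<times> tuples T ?A"
      using ne fin tne by (simp add: ideal_source_def)
  qed
  finally show ?thesis .
qed

text \<open>One choice of signs must serve all hash functions, so the average over \<H> is taken
  before \<open>S\<close> is picked. The 64 is 4 from Khintchine, 8 from the product bound, and 2
  from passing from l1 to statistical distance.\<close>

lemma exists_far_hashed_source:
  fixes \<H> :: "(nat \<Rightarrow> nat) multiset" and r :: real
  assumes \<H>: "hash_family N M \<H>" and "2 \<le> M" "T > 0" "M \<le> n" "n \<le> N"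
    and r: "0 \<le> r" "r \<le> 1" "r\<^sup>2 \<le> real T * real M / (72 * real n)"
  obtains p where "set_pmf p \<subseteq> {1..N}" "collision_prob p \<le> 9 / n"
    "r / 64 \<le> stat_dist (hashed_source \<H> (replicate_pmf T p)) (ideal_source \<H> T M)"
proof -
  define I where "I = {1..n}"
  have I: "finite I" "I \<noteq> {}" "card I = n" using assms by (auto simp: I_def)
  let ?H = "pmf_of_multiset \<H>"
  let ?D = "\<lambda>S h y. min 1 (sqrt T * real M *
    \<bar>pmf (map_pmf h (perturbed_uniform I S)) y - 1 / real M\<bar>)"
  define F where "F S = (\<Sum>h\<in>set_mset \<H>. pmf ?H h * (\<Sum>y\<in>{1..M}. ?D S h y)) / (8 * real M)" for S
  have "\<H> \<noteq> {#}" using \<H> by (simp add: hash_family_def)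
  then have H1: "(\<Sum>h\<in>set_mset \<H>. pmf ?H h) = 1" by (intro sum_pmf_eq_1) auto
  have "(\<Sum>S\<in>Pow I. r / 32) =
      (\<Sum>h\<in>set_mset \<H>. pmf ?H h * (\<Sum>y\<in>{1..M}. 2 ^ card I * (r / 4))) / (8 * real M)"
    unfolding sum_distrib_right[symmetric] H1 using \<open>2 \<le> M\<close> I by (simp add: card_Pow)
  also have "\<dots> \<le> (\<Sum>h\<in>set_mset \<H>. pmf ?H h * (\<Sum>y\<in>{1..M}. \<Sum>S\<in>Pow I. ?D S h y)) / (8 * real M)"
    using assms I
    by (intro divide_right_mono sum_mono mult_left_mono sum_perturbed_uniform_deviation_ge) auto
  also have "\<dots> = (\<Sum>S\<in>Pow I. F S)"
    unfolding F_def sum_divide_distrib[symmetric] sum.swap[of _ "Pow I" "{1..M}"]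
    by (simp add: sum_distrib_left sum.swap[of _ "Pow I"])
  finally have "\<not> (\<forall>S\<in>Pow I. F S < r / 32)"
    using I sum_strict_mono[of "Pow I" F "\<lambda>_. r / 32"] by auto
  then obtain S where S: "S \<subseteq> I" "r / 32 \<le> F S" by auto
  show ?thesis
  proof (rule that[of "perturbed_uniform I S"])
    show *: "set_pmf (perturbed_uniform I S) \<subseteq> {1..N}"
      using set_pmf_perturbed_uniform[OF I(1,2) S(1)] \<open>n \<le> N\<close> by (auto simp: I_def)
    show "collision_prob (perturbed_uniform I S) \<le> 9 / n"
      using collision_prob_perturbed_uniform[OF I(1,2) S(1)] I by simp
    show "r / 64 \<le> stat_dist (hashed_source \<H> (replicate_pmf T (perturbed_uniform I S)))
        (ideal_source \<H> T M)"
      using stat_dist_hashed_replicate_pmf_ge[OF \<H> _ \<open>T > 0\<close> *] \<open>2 \<le> M\<close> S(2)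
      unfolding F_def by simp
  qed
qed

text \<open>For \<open>M = 1\<close> there is only one output string and the two distributions
  coincide, so no block source could be far; hence \<open>M > 1\<close>.\<close>

theorem theorem4p1:
  shows "\<exists>\<epsilon>\<^sub>0 c :: real. \<epsilon>\<^sub>0 > 0 \<and> c > 0 \<and>
    (\<forall>(N :: nat) (M :: nat) (T :: nat) (\<epsilon> :: real) (\<H> :: (nat \<Rightarrow> nat) multiset).
       N > 0 \<and> M > 1 \<and> T > 0 \<and> 0 < \<epsilon> \<and> \<epsilon> < \<epsilon>\<^sub>0 \<and>
       real N \<ge> real M * real T / \<epsilon>\<^sup>2 \<and> hash_family N M \<H> \<longrightarrow>
       (\<exists>(K :: nat) (X :: nat list pmf).
          real K \<ge> c * (real M * real T / \<epsilon>\<^sup>2) \<and>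
          block_source K T {1..N} X \<and>
          eps_far \<epsilon> (hashed_source \<H> X) (ideal_source \<H> T M)))"
proof (rule exI[of _ "1 / 10000"], rule exI[of _ "1 / 10000000"],
    intro conjI allI impI; (elim conjE)?)
  show "(1 / 10000 :: real) > 0" "(1 / 10000000 :: real) > 0" by simp_all
  fix N M T :: nat and \<epsilon> :: real and \<H> :: "(nat \<Rightarrow> nat) multiset"
  assume M: "M > 1" and T: "T > 0" and \<epsilon>: "0 < \<epsilon>" "\<epsilon> < 1 / 10000"
    and N: "real N \<ge> real M * real T / \<epsilon>\<^sup>2" and \<H>: "hash_family N M \<H>"
  define R where "R = real M * real T / \<epsilon>\<^sup>2"
  \<comment> \<open>\<open>r = 64 \<epsilon>\<close> below requires \<open>72 \<cdot> 64\<^sup>2 n = 294912 n \<le> R\<close>.\<close>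
  define n where "n = nat \<lfloor>R / 300000\<rfloor>"
  \<comment> \<open>Dividing by 9 matches the collision bound \<open>9 / n\<close>. Up to rounding
    \<open>K\<close> is R / 2700000, and the slack down to R / 10000000 absorbs the two
    roundings.\<close>
  define K where "K = n div 9"
  have e2: "\<epsilon>\<^sup>2 \<le> (1 / 10000)\<^sup>2" using \<epsilon> by (intro power_mono) auto
  \<comment> \<open>The upper bound on \<epsilon> makes \<open>R\<close> large compared with
    \<open>M\<close>, which yields \<open>M \<le> n\<close> and makes the rounding losses
    harmless.\<close>
  have "100000000 \<le> 1 / \<epsilon>\<^sup>2"
    using \<epsilon> e2 by (simp add: pos_le_divide_eq power_divide)
  then have "real M * 1 * 100000000 \<le> real M * real T * (1 / \<epsilon>\<^sup>2)"
    using T by (intro mult_mono) auto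
  then have R: "100000000 * real M \<le> R" by (simp add: R_def)
  have M2: "2 \<le> real M" using M by simp
  have "real n = of_int \<lfloor>R / 300000\<rfloor>" using R M2 by (simp add: n_def)
  then have n: "real n \<le> R / 300000" "R / 300000 - 1 \<le> real n" by linarith+
  have "real M \<le> real n" using n R M2 by linarith
  then have "M \<le> n" by simp
  then have "n > 0" using M by simp
  have "real n \<le> real N" using n R M2 N unfolding R_def[symmetric] by linarith
  then have "n \<le> N" by simp
  have K: "real n / 9 - 1 \<le> real K" "real K \<le> real n / 9" unfolding K_def by linarith+
  \<comment> \<open>Positivity matters: for \<open>K = 0\<close> the collision bound
    \<open>1 / real K\<close> would be 0.\<close>
  have "real K > 0" using K n R M2 by linarith
  then have "K > 0" by simp
  have "(64 * \<epsilon>)\<^sup>2 \<le> real T * real M / (72 * real n)"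
  proof -
    have "72 * real n * (64 * \<epsilon>)\<^sup>2 \<le> 72 * (R / 300000) * (64 * \<epsilon>)\<^sup>2"
      using n by (intro mult_right_mono mult_left_mono) auto
    also have "\<dots> = 294912 / 300000 * (real T * real M)"
      using \<epsilon> by (simp add: R_def power_mult_distrib field_simps)
    also have "\<dots> \<le> real T * real M" by simp
    finally show ?thesis using \<open>n > 0\<close> by (simp add: field_simps)
  qed
  then obtain p where p: "set_pmf p \<subseteq> {1..N}" "collision_prob p \<le> 9 / n"
      "64 * \<epsilon> / 64 \<le> stat_dist (hashed_source \<H> (replicate_pmf T p)) (ideal_source \<H> T M)"
    using exists_far_hashed_source[of N M \<H> T n "64 * \<epsilon>"] \<H> M T \<open>M \<le> n\<close> \<open>n \<le> N\<close> \<epsilon> by auto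
  have "9 / real n \<le> 1 / real K"
    using K \<open>K > 0\<close> \<open>n > 0\<close> by (simp add: field_simps)
  with p have "block_source K T {1..N} (replicate_pmf T p)"
    by (intro block_source_replicate_pmf) auto
  moreover have "real K \<ge> 1 / 10000000 * (real M * real T / \<epsilon>\<^sup>2)"
    using K n R M2 unfolding R_def[symmetric] by linarith
  ultimately show "\<exists>K X. real K \<ge> 1 / 10000000 * (real M * real T / \<epsilon>\<^sup>2) \<and>
      block_source K T {1..N} X \<and> eps_far \<epsilon> (hashed_source \<H> X) (ideal_source \<H> T M)"
    using p(3) unfolding eps_far_def by auto
qed

end
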